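(* Let $r$ be a nonnegative integer. For every integer $n\ge 0$, $$\beta_{n,\lambda}(r)=\sum_{k=0}^{n}\frac{(-1)^{k}}{k+1}\,k!\,S_{2,\lambda}^{(r)}(n+r,k+r)=\sum_{k=0}^{n}\frac{1}{k+1}\sum_{j=0}^{k}\binom{k}{j}(-1)^{j}(r+j)_{n,\lambda}.$$
   Context: Let $\lambda\in\mathbb{R}$. $(x)_{0,\lambda}=1$, $(x)_{n,\lambda}=x(x-\lambda)\cdots(x-(n-1)\lambda)$ for $n\ge1$; $(x)_0=1$, $(x)_n=x(x-1)\cdots(x-n+1)$. $e_\lambda^x(t)=\sum_{k\ge0}(x)_{k,\lambda}t^k/k!$ (formal power series), $e_\lambda(t)=e_\lambda^1(t)$. The fully degenerate Bernoulli polynomials are defined by $\frac{\log(1+\lambda t)}{\lambda(e_\lambda(t)-1)}e_\lambda^x(t)=\sum_{n\ge0}\beta_{n,\lambda}(x)\frac{t^n}{n!}$ (for $\lambda=0$ interpret $\log(1+\lambda t)/\lambda$ as $t$ and $e_0^x(t)=e^{xt}$). For an integer $r\ge0$, the degenerate $r$-Stirling numbers of the second kind are defined by $(x+r)_{n,\lambda}=\sum_{k=0}^{n}S^{(r)}_{2,\lambda}(n+r,k+r)(x)_k$ for $n\ge0$; equivalently $e_\lambda^r(t)\frac{1}{k!}(e_\lambda(t)-1)^k=\sum_{n\ge k}S^{(r)}_{2,\lambda}(n+r,k+r)\frac{t^n}{n!}$. *)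

theory Defs
  imports "HOL-Computational_Algebra.Formal_Power_Series"
begin

definition falling_fact :: "real \<Rightarrow> nat \<Rightarrow> real" where
  "falling_fact x n = (\<Prod>i<n. x - real i)"

definition degenerate_falling_fact :: "real \<Rightarrow> real \<Rightarrow> nat \<Rightarrow> real" where
  "degenerate_falling_fact lam x n = (\<Prod>i<n. x - real i * lam)"

definition degenerate_exp :: "real \<Rightarrow> real \<Rightarrow> real fps" where
  "degenerate_exp lam x = Abs_fps (\<lambda>k. degenerate_falling_fact lam x k / fact k)"

text \<open>The series \<open>log (1 + lam t) / lam\<close>, read as \<open>t\<close> when \<open>lam = 0\<close>;
  \<^term>\<open>fps_ln 1\<close> is the series of \<open>log (1 + t)\<close>.\<close>

definition degenerate_log_quot :: "real \<Rightarrow> real fps" where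
  "degenerate_log_quot lam =
     (if lam = 0 then fps_X
      else fps_const (1 / lam) * (fps_ln 1 oo (fps_const lam * fps_X)))"

text \<open>Both the numerator and the denominator of the quotient below have zero constant
  term and linear coefficient 1, so the division of power series is exact.\<close>

definition fully_degenerate_bernoulli :: "real \<Rightarrow> nat \<Rightarrow> real \<Rightarrow> real" where
  "fully_degenerate_bernoulli lam n x =
     fact n * fps_nth (degenerate_log_quot lam / (degenerate_exp lam 1 - 1) * degenerate_exp lam x) n"

definition degenerate_r_stirling_expansion ::
    "real \<Rightarrow> nat \<Rightarrow> nat \<Rightarrow> (nat \<Rightarrow> real) \<Rightarrow> bool" where
  "degenerate_r_stirling_expansion lam r n c \<longleftrightarrow>
     (\<forall>k>n. c k = 0) \<and>
     (\<forall>x. degenerate_falling_fact lam (x + real r) n = (\<Sum>k=0..n. c k * falling_fact x k))"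

text \<open>As in the usual notation, both arguments are shifted by \<open>r\<close>: the number
  \<open>S(n + r, k + r)\<close> is the coefficient of the \<open>k\<close>-th falling factorial in the
  expansion of degree \<open>n\<close>. Values at arguments below \<open>r\<close> carry no meaning.\<close>

definition degenerate_r_stirling2 :: "real \<Rightarrow> nat \<Rightarrow> nat \<Rightarrow> nat \<Rightarrow> real" where
  "degenerate_r_stirling2 lam r m l =
     (THE c. degenerate_r_stirling_expansion lam r (m - r) c) (l - r)"

lemma degenerate_exp_0: "degenerate_exp 0 x = fps_exp x"
  by (rule fps_ext) (simp add: degenerate_exp_def degenerate_falling_fact_def)

lemma falling_fact_Suc: "falling_fact x (Suc n) = falling_fact x n * (x - real n)"
  by (simp add: falling_fact_def)

lemma falling_fact_of_nat_eq_0: "m < k \<Longrightarrow> falling_fact (real m) k = 0"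
  by (auto simp: falling_fact_def)

lemma falling_fact_of_nat_self_nonzero: "falling_fact (real m) m \<noteq> 0"
  by (auto simp: falling_fact_def)

lemma falling_fact_sum_eq_0:
  assumes "\<And>x. (\<Sum>k=0..n. d k * falling_fact x k) = 0" "m \<le> n"
  shows "d m = 0"
  using assms(2)
proof (induction m rule: less_induct)
  case (less m)
  have "(\<Sum>k=0..n. d k * falling_fact (real m) k) = (\<Sum>k\<in>{m}. d k * falling_fact (real m) k)"
  proof (rule sum.mono_neutral_right)
    show "\<forall>i\<in>{0..n} - {m}. d i * falling_fact (real m) i = 0"
    proof
      fix i assume i: "i \<in> {0..n} - {m}"
      show "d i * falling_fact (real m) i = 0"
        using i less falling_fact_of_nat_eq_0[of m i] by (cases "i < m") auto
    qed
  qed (use less in auto)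
  then show ?case
    using assms(1)[of "real m"] falling_fact_of_nat_self_nonzero[of m] by simp
qed

lemma degenerate_r_stirling_expansion_exists:
  "\<exists>c. degenerate_r_stirling_expansion lam r n c"
proof (induction n)
  case 0
  show ?case
    by (rule exI[of _ "\<lambda>k. if k = 0 then 1 else 0"])
       (simp add: degenerate_r_stirling_expansion_def degenerate_falling_fact_def falling_fact_def)
next
  case (Suc n)
  then obtain c where c0: "\<And>k. k > n \<Longrightarrow> c k = 0"
    and c: "\<And>x. degenerate_falling_fact lam (x + real r) n = (\<Sum>k=0..n. c k * falling_fact x k)"
    by (auto simp: degenerate_r_stirling_expansion_def)
  define a where "a k = real k + real r - real n * lam" for k
  define c' where "c' k = (if k = 0 then 0 else c (k - 1)) + a k * c k" for k
  have "degenerate_falling_fact lam (x + real r) (Suc n) = (\<Sum>k=0..Suc n. c' k * falling_fact x k)" for x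
  proof -
    have "degenerate_falling_fact lam (x + real r) (Suc n) =
        (\<Sum>k=0..n. c k * falling_fact x k) * (x + real r - real n * lam)"
      by (simp add: c[symmetric] degenerate_falling_fact_def)
    also have "\<dots> = (\<Sum>k=0..n. c k * falling_fact x (Suc k)) + (\<Sum>k=0..n. a k * c k * falling_fact x k)"
      unfolding sum_distrib_right sum.distrib[symmetric]
      by (rule sum.cong) (auto simp: falling_fact_Suc a_def algebra_simps)
    also have "(\<Sum>k=0..n. c k * falling_fact x (Suc k)) =
        (\<Sum>k=0..Suc n. (if k = 0 then 0 else c (k - 1)) * falling_fact x k)"
      by (simp only: sum.atLeast0_atMost_Suc_shift) simp
    also have "(\<Sum>k=0..n. a k * c k * falling_fact x k) = (\<Sum>k=0..Suc n. a k * c k * falling_fact x k)"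
      by (simp add: c0)
    finally show ?thesis
      by (simp only: c'_def distrib_right sum.distrib)
  qed
  moreover have "c' k = 0" if "k > Suc n" for k
    using that c0 by (auto simp: c'_def)
  ultimately show ?case
    by (auto simp: degenerate_r_stirling_expansion_def)
qed

lemma degenerate_r_stirling_expansion_unique:
  assumes "degenerate_r_stirling_expansion lam r n c" "degenerate_r_stirling_expansion lam r n d"
  shows "c = d"
proof
  fix k
  have "(\<Sum>k=0..n. (c k - d k) * falling_fact x k) = 0" for x
    using assms by (simp add: degenerate_r_stirling_expansion_def left_diff_distrib sum_subtractf)
  from falling_fact_sum_eq_0[of "\<lambda>k. c k - d k" n, OF this] assms show "c k = d k"
    by (cases "k \<le> n") (auto simp: degenerate_r_stirling_expansion_def)
qed

lemma degenerate_r_stirling2_expansion: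
  "degenerate_falling_fact lam (x + real r) n =
     (\<Sum>k=0..n. degenerate_r_stirling2 lam r (n + r) (k + r) * falling_fact x k)"
proof -
  have "\<exists>!c. degenerate_r_stirling_expansion lam r n c"
    using degenerate_r_stirling_expansion_exists degenerate_r_stirling_expansion_unique by blast
  from theI'[OF this] show ?thesis
    by (simp add: degenerate_r_stirling_expansion_def[of _ _ _ "The _"] degenerate_r_stirling2_def)
qed

end

theory Submission
  imports Defs
begin

text \<open>
  Put \<open>u = e\<^sub>\<lambda>(t) - 1\<close>. Comparing derivatives gives \<open>log (1 + \<lambda>t) / \<lambda> = log (1 + u)\<close>, so the
  generating function of the fully degenerate Bernoulli numbers at \<open>r\<close> is
  \<open>(log (1 + u) / u) e\<^sub>\<lambda>\<^sup>r(t) = (\<Sum>k. (-1)\<^sup>k / (k + 1) u\<^sup>k) e\<^sub>\<lambda>\<^sup>r(t)\<close>. Expanding \<open>u\<^sup>k e\<^sub>\<lambda>\<^sup>r(t)\<close> by the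
  binomial theorem gives the double sum, and the inner alternating sum is, up to the sign \<open>(-1)\<^sup>k\<close>, the \<open>k\<close>-th finite
  difference at \<open>0\<close> of \<open>x \<mapsto> (x + r)\<^bsub>n,\<lambda>\<^esub>\<close>, which is \<open>k!\<close> times the coefficient of \<open>(x)\<^sub>k\<close>.
\<close>

lemma degenerate_exp_nth_0 [simp]: "fps_nth (degenerate_exp lam x) 0 = 1"
  by (simp add: degenerate_exp_def degenerate_falling_fact_def)

lemma degenerate_exp_nth_Suc:
  "real (Suc n) * fps_nth (degenerate_exp lam x) (Suc n) =
     (x - real n * lam) * fps_nth (degenerate_exp lam x) n"
proof -
  have "real (Suc n) * (c * d / (real (Suc n) * f)) = d * (c / f)" for c d f :: real
    by (simp del: of_nat_Suc)
  then show ?thesis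
    by (simp add: degenerate_exp_def degenerate_falling_fact_def del: of_nat_Suc)
qed

lemma nth_one_plus_const_X_mult_deriv:
  fixes F :: "real fps"
  shows "fps_nth ((1 + fps_const lam * fps_X) * fps_deriv F) n =
     real (Suc n) * fps_nth F (Suc n) + lam * real n * fps_nth F n"
  by (cases n) (simp_all add: distrib_right mult.assoc)

lemma degenerate_exp_deriv:
  "(1 + fps_const lam * fps_X) * fps_deriv (degenerate_exp lam x) =
     fps_const x * degenerate_exp lam x"
  by (rule fps_ext, simp only: nth_one_plus_const_X_mult_deriv degenerate_exp_nth_Suc)
     (simp add: algebra_simps)

text \<open>Comparing coefficients turns the differential equation into a first-order recurrence,
  which the constant term starts.\<close>

lemma degenerate_exp_unique:
  assumes "(1 + fps_const lam * fps_X) * fps_deriv F = fps_const x * F" "fps_nth F 0 = 1"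
  shows "F = degenerate_exp lam x"
proof (rule fps_ext)
  fix n
  show "fps_nth F n = fps_nth (degenerate_exp lam x) n"
  proof (induction n)
    case (Suc n)
    have "real (Suc n) * fps_nth F (Suc n) = (x - real n * lam) * fps_nth F n"
      using nth_one_plus_const_X_mult_deriv[of lam F n, unfolded assms(1)]
      by (simp add: algebra_simps del: of_nat_Suc)
    then have "real (Suc n) * fps_nth F (Suc n) =
        real (Suc n) * fps_nth (degenerate_exp lam x) (Suc n)"
      by (simp only: degenerate_exp_nth_Suc Suc.IH)
    then show ?case
      by (simp del: of_nat_Suc)
  qed (simp add: assms)
qed

text \<open>By the Leibniz rule the product solves the differential equation for exponent
  \<open>x + y\<close>, so uniqueness applies.\<close>

lemma degenerate_exp_add:
  "degenerate_exp lam (x + y) = degenerate_exp lam x * degenerate_exp lam y"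
proof (rule degenerate_exp_unique[symmetric])
  let ?a = "1 + fps_const lam * fps_X" and ?E = "degenerate_exp lam"
  have "?a * fps_deriv (?E x * ?E y) = ?E x * (?a * fps_deriv (?E y)) + (?a * fps_deriv (?E x)) * ?E y"
    by (simp only: fps_deriv_mult) (simp only: algebra_simps)
  then show "?a * fps_deriv (?E x * ?E y) = fps_const (x + y) * (?E x * ?E y)"
    by (simp only: degenerate_exp_deriv fps_const_add[symmetric]) (simp only: algebra_simps)
qed simp

lemma degenerate_exp_mult_power:
  "degenerate_exp lam x * degenerate_exp lam 1 ^ j = degenerate_exp lam (x + real j)"
proof (induction j)
  case (Suc j)
  have "degenerate_exp lam x * degenerate_exp lam 1 ^ Suc j =
      (degenerate_exp lam x * degenerate_exp lam 1 ^ j) * degenerate_exp lam 1"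
    by (simp add: algebra_simps)
  then show ?case
    by (simp add: Suc degenerate_exp_add[symmetric] algebra_simps)
qed simp

text \<open>The derivative is \<open>1 / (1 + lam t)\<close> in both branches of the definition; the
  product form avoids inverting a series.\<close>

lemma degenerate_log_quot_deriv:
  "(1 + fps_const lam * fps_X) * fps_deriv (degenerate_log_quot lam) = 1"
proof (cases "lam = 0")
  case False
  let ?b = "fps_const lam * fps_X :: real fps"
  have "fps_deriv (fps_ln 1 oo ?b) = inverse (1 + ?b) * fps_const lam"
    by (subst fps_compose_deriv)
       (simp_all add: fps_ln_deriv fps_inverse_compose fps_compose_add_distrib)
  then have "(1 + ?b) * fps_deriv (degenerate_log_quot lam) =
      (inverse (1 + ?b) * (1 + ?b)) * (fps_const (1 / lam) * fps_const lam)"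
    using False by (simp add: degenerate_log_quot_def algebra_simps del: fps_const_mult)
  then show ?thesis
    using False by (simp add: inverse_mult_eq_1)
qed (simp add: degenerate_log_quot_def)

text \<open>Both sides have constant term 0. By the chain rule the right side has derivative
  \<open>E' / E\<close> with \<open>E = degenerate_exp lam 1\<close>, and
  \<open>(1 + lam t) E' = E\<close>.\<close>

lemma degenerate_log_quot_eq_ln:
  "degenerate_log_quot lam = fps_ln 1 oo (degenerate_exp lam 1 - 1)"
proof -
  let ?a = "1 + fps_const lam * fps_X :: real fps" and ?E = "degenerate_exp lam 1"
  have "fps_deriv (fps_ln 1 oo (?E - 1)) = inverse ?E * fps_deriv ?E"
    by (subst fps_compose_deriv)
       (simp_all add: fps_ln_deriv fps_inverse_compose fps_compose_add_distrib)
  then have "?a * fps_deriv (fps_ln 1 oo (?E - 1)) = inverse ?E * (?a * fps_deriv ?E)"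
    by (simp only: mult.left_commute)
  also have "\<dots> = ?a * fps_deriv (degenerate_log_quot lam)"
    by (simp only: degenerate_exp_deriv degenerate_log_quot_deriv) (simp add: inverse_mult_eq_1)
  finally have "?a * fps_deriv (fps_ln 1 oo (?E - 1)) = ?a * fps_deriv (degenerate_log_quot lam)" .
  moreover have "?a \<noteq> 0"
    by (auto dest: arg_cong[of _ _ "\<lambda>f. fps_nth f 0"])
  ultimately have "fps_deriv (degenerate_log_quot lam) = fps_deriv (fps_ln 1 oo (?E - 1))"
    by simp
  moreover have "fps_nth (degenerate_log_quot lam) 0 = 0"
    by (simp add: degenerate_log_quot_def)
  ultimately show ?thesis
    by (simp add: fps_deriv_eq_iff)
qed

text \<open>Write \<open>log (1 + X)\<close> as a series times \<open>X\<close> and substitute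
  \<open>u\<close> for \<open>X\<close>; the factor \<open>u\<close> then cancels.\<close>

lemma degenerate_log_quot_divide:
  "degenerate_log_quot lam / (degenerate_exp lam 1 - 1) =
     Abs_fps (\<lambda>k. (-1) ^ k / (real k + 1)) oo (degenerate_exp lam 1 - 1)"
    (is "_ / ?u = ?Q oo _")
proof -
  have "fps_ln 1 = ?Q * fps_X"
    by (rule fps_ext) (auto simp: fps_ln_nth of_nat_diff)
  then have "degenerate_log_quot lam = (?Q oo ?u) * ?u"
    by (simp add: degenerate_log_quot_eq_ln fps_compose_mult_distrib)
  \<comment> \<open>The linear coefficient is 1, by the recurrence at index 0.\<close>
  moreover have "fps_nth ?u 1 \<noteq> 0"
    using degenerate_exp_nth_Suc[of 0 lam 1] by simp
  then have "?u \<noteq> 0"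
    by (metis fps_zero_nth)
  ultimately show ?thesis
    by simp
qed

text \<open>Since \<open>u ^ k\<close> has no terms of degree below \<open>k\<close>, the powers
  with \<open>k > n\<close> do not reach coefficient \<open>n\<close>.\<close>

lemma fps_compose_mult_nth:
  fixes f u g :: "'a::comm_ring_1 fps"
  assumes "fps_nth u 0 = 0"
  shows "fps_nth ((f oo u) * g) n = (\<Sum>k=0..n. fps_nth f k * fps_nth (u ^ k * g) n)"
proof -
  have "fps_nth (f oo u) i = (\<Sum>k=0..n. fps_nth f k * fps_nth (u ^ k) i)" if "i \<le> n" for i
    unfolding fps_compose_nth using that startsby_zero_power_prefix[OF assms]
    by (intro sum.mono_neutral_left) auto
  then have "fps_nth ((f oo u) * g) n =
      (\<Sum>i=0..n. \<Sum>k=0..n. fps_nth f k * fps_nth (u ^ k) i * fps_nth g (n - i))"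
    by (simp add: fps_mult_nth sum_distrib_right)
  also have "\<dots> = (\<Sum>k=0..n. fps_nth f k * fps_nth (u ^ k * g) n)"
    by (subst sum.swap) (simp add: fps_mult_nth sum_distrib_left mult.assoc)
  finally show ?thesis .
qed

lemma one_minus_power:
  fixes a :: "'a::comm_ring_1"
  shows "(1 - a) ^ k = (\<Sum>j=0..k. of_nat (k choose j) * (-1) ^ j * a ^ j)"
  using binomial_ring[of "- a" 1 k]
  by (simp add: atMost_atLeast0 power_minus[of a] mult.assoc)

text \<open>The sign turns \<open>(E - 1) ^ k\<close> into \<open>(1 - E) ^ k\<close>; in its
  binomial expansion each power \<open>E ^ j\<close> shifts the exponent \<open>x\<close> by
  \<open>j\<close>.\<close>

lemma degenerate_exp_minus_one_power_nth:
  "(-1) ^ k * (fact n * fps_nth ((degenerate_exp lam 1 - 1) ^ k * degenerate_exp lam x) n) =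
     (\<Sum>j=0..k. real (k choose j) * (-1) ^ j * degenerate_falling_fact lam (x + real j) n)"
proof -
  let ?E = "degenerate_exp lam"
  have "fps_const ((-1) ^ k) * ((?E 1 - 1) ^ k * ?E x) = (1 - ?E 1) ^ k * ?E x"
    by (simp add: mult.assoc[symmetric] fps_const_power[symmetric] power_mult_distrib[symmetric]
        fps_const_neg[symmetric] del: fps_const_power fps_const_neg)
  also have "\<dots> = (\<Sum>j=0..k. fps_const (real (k choose j) * (-1) ^ j) * (?E x * ?E 1 ^ j))"
    unfolding one_minus_power sum_distrib_right
    by (rule sum.cong) (simp_all add: fps_of_nat[symmetric] fps_const_mult[symmetric]
        fps_const_power[symmetric] fps_const_neg[symmetric] mult_ac
        del: fps_const_power fps_const_neg fps_const_mult)
  finally have "fps_nth (fps_const ((-1) ^ k) * ((?E 1 - 1) ^ k * ?E x)) n =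
      (\<Sum>j=0..k. real (k choose j) * (-1) ^ j * fps_nth (?E (x + real j)) n)"
    by (simp add: degenerate_exp_mult_power fps_sum_nth)
  then have "(-1) ^ k * fps_nth ((?E 1 - 1) ^ k * ?E x) n =
      (\<Sum>j=0..k. real (k choose j) * (-1) ^ j * fps_nth (?E (x + real j)) n)"
    by simp
  then have "fact n * ((-1) ^ k * fps_nth ((?E 1 - 1) ^ k * ?E x) n) =
      (\<Sum>j=0..k. real (k choose j) * (-1) ^ j * degenerate_falling_fact lam (x + real j) n)"
    by (simp add: sum_distrib_left degenerate_exp_def)
  then show ?thesis
    by (simp only: mult.left_commute)
qed

lemma falling_fact_eq_gbinomial: "falling_fact x l = fact l * (x gchoose l)"
  by (simp add: falling_fact_def gbinomial_prod_rev atLeast0LessThan)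

text \<open>After division by \<open>fact l\<close>, the left side is coefficient \<open>l\<close>
  of the binomial expansion of \<open>(1 - (1 + X)) ^ k = (- X) ^ k\<close>.\<close>

lemma alternating_sum_choose_falling_fact:
  "(\<Sum>j=0..k. real (k choose j) * (-1) ^ j * falling_fact (real j) l) =
     (if l = k then (-1) ^ k * fact k else 0)"
proof -
  let ?X = "fps_X :: real fps"
  have "(\<Sum>j=0..k. of_nat (k choose j) * (-1) ^ j * (1 + ?X) ^ j) = (- 1) ^ k * ?X ^ k"
    by (simp only: one_minus_power[symmetric]) (simp add: power_minus[of ?X])
  then have "(\<Sum>j=0..k. fps_const (real (k choose j) * (-1) ^ j) * fps_binomial (real j)) =
      fps_const ((-1) ^ k) * ?X ^ k"
    by (simp add: fps_of_nat[symmetric] fps_const_mult[symmetric] fps_binomial_of_nat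
        fps_const_power[symmetric] fps_const_neg[symmetric]
        del: fps_const_power fps_const_neg fps_const_mult)
  then have "fps_nth (\<Sum>j=0..k. fps_const (real (k choose j) * (-1) ^ j) * fps_binomial (real j)) l =
      fps_nth (fps_const ((-1) ^ k) * ?X ^ k) l"
    by (rule arg_cong)
  then have "(\<Sum>j=0..k. real (k choose j) * (-1) ^ j * (real j gchoose l)) =
      (if l = k then (-1) ^ k else 0)"
    by (simp add: fps_sum_nth)
  then have "fact l * (\<Sum>j=0..k. real (k choose j) * (-1) ^ j * (real j gchoose l)) =
      fact l * (if l = k then (-1) ^ k else 0)"
    by (rule arg_cong)
  then show ?thesis
    by (simp add: falling_fact_eq_gbinomial sum_distrib_left mult_ac)
qed

text \<open>In the falling factorial expansion, the alternating sum over \<open>j\<close>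
  annihilates every term except \<open>l = k\<close>.\<close>

lemma alternating_sum_degenerate_falling_fact:
  assumes "k \<le> n"
  shows "(\<Sum>j=0..k. real (k choose j) * (-1) ^ j * degenerate_falling_fact lam (real r + real j) n) =
     (-1) ^ k * fact k * degenerate_r_stirling2 lam r (n + r) (k + r)"
proof -
  let ?S = "\<lambda>l. degenerate_r_stirling2 lam r (n + r) (l + r)"
  have "(\<Sum>j=0..k. real (k choose j) * (-1) ^ j * degenerate_falling_fact lam (real r + real j) n) =
      (\<Sum>j=0..k. \<Sum>l=0..n. ?S l * (real (k choose j) * (-1) ^ j * falling_fact (real j) l))"
    \<comment> \<open>Swapping the summands gives \<open>real j + real r\<close>, so the expansion
      applies at the point \<open>real j\<close>.\<close>
    by (subst add.commute, simp only: degenerate_r_stirling2_expansion)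
       (simp add: sum_distrib_left mult_ac)
  also have "\<dots> = (\<Sum>l=0..n. ?S l * (if l = k then (-1) ^ k * fact k else 0))"
    by (subst sum.swap) (simp only: sum_distrib_left[symmetric] alternating_sum_choose_falling_fact)
  also have "\<dots> = (\<Sum>l=0..n. if l = k then ?S k * ((-1) ^ k * fact k) else 0)"
    by (rule sum.cong) auto
  also have "\<dots> = (-1) ^ k * fact k * ?S k"
    using assms by simp
  finally show ?thesis .
qed

text \<open>The sign \<open>(-1) ^ k\<close> from the logarithm series is exactly the one absorbed
  by the binomial expansion of the \<open>k\<close>-th power.\<close>

lemma fully_degenerate_bernoulli_eq_sum:
  "fully_degenerate_bernoulli lam n x =
     (\<Sum>k=0..n. 1 / (real k + 1) *
        (\<Sum>j=0..k. real (k choose j) * (-1) ^ j * degenerate_falling_fact lam (x + real j) n))"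
  unfolding fully_degenerate_bernoulli_def degenerate_log_quot_divide
  by (simp add: fps_compose_mult_nth degenerate_exp_minus_one_power_nth[symmetric])
     (simp add: sum_distrib_left mult_ac)

theorem theorem3:
  fixes lam :: real and r n :: nat
  shows "fully_degenerate_bernoulli lam n (real r) =
           (\<Sum>k=0..n. (-1) ^ k / (real k + 1) * fact k * degenerate_r_stirling2 lam r (n + r) (k + r))
       \<and> (\<Sum>k=0..n. (-1) ^ k / (real k + 1) * fact k * degenerate_r_stirling2 lam r (n + r) (k + r)) =
           (\<Sum>k=0..n. 1 / (real k + 1) *
              (\<Sum>j=0..k. real (k choose j) * (-1) ^ j * degenerate_falling_fact lam (real r + real j) n))"
proof -
  have "(\<Sum>k=0..n. (-1) ^ k / (real k + 1) * fact k * degenerate_r_stirling2 lam r (n + r) (k + r)) =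
      (\<Sum>k=0..n. 1 / (real k + 1) *
         (\<Sum>j=0..k. real (k choose j) * (-1) ^ j * degenerate_falling_fact lam (real r + real j) n))"
    by (rule sum.cong) (simp_all add: alternating_sum_degenerate_falling_fact)
  then show ?thesis
    by (simp add: fully_degenerate_bernoulli_eq_sum)
qed

end
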